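(* Let $a,b,c,d>0$ be real numbers with $c+d\le a+b$. Then $$\max(a+b,c+d)=\lim_{\kappa\to-\infty}\frac{2}{\sqrt{-\kappa}}\operatorname{arcsinh}\left[\sinh\left(\tfrac{\sqrt{-\kappa}}{2}a\right)\sinh\left(\tfrac{\sqrt{-\kappa}}{2}b\right)+\sinh\left(\tfrac{\sqrt{-\kappa}}{2}c\right)\sinh\left(\tfrac{\sqrt{-\kappa}}{2}d\right)\right]$$ and $$a+b=\lim_{\kappa\to-\infty}\frac{2}{\sqrt{-\kappa}}\operatorname{arcsinh}\left[\sinh\left(\tfrac{\sqrt{-\kappa}}{2}a\right)\sinh\left(\tfrac{\sqrt{-\kappa}}{2}b\right)\right].$$
   Context: Here $\kappa$ ranges over negative real numbers. *)

theory Defs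
  imports Complex_Main
begin

end

theory Submission
  imports Defs "HOL-Real_Asymp.Real_Asymp"
begin

text \<open>With t = sqrt (- \<kappa>) / 2, each argument of arsinh lies, for large t, between two positive
  constant multiples of exp (t (a + b)), and arsinh (k exp (t s)) / t tends to s whatever k > 0 is.\<close>

lemma sinh_mult_le_exp:
  fixes x y :: real
  assumes "x \<ge> 0" and "y \<ge> 0"
  shows "sinh x * sinh y \<le> exp (x + y) / 4"
proof -
  \<comment> \<open>Each factor is bounded by dropping the negative term of
    \<open>sinh u = (exp u - exp (- u)) / 2\<close>.\<close>
  have "sinh x * sinh y \<le> (exp x / 2) * (exp y / 2)"
    using assms by (intro mult_mono) (simp_all add: sinh_def)
  then show ?thesis
    by (simp add: exp_add)
qed

lemma eventually_exp_le_sinh_mult: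
  fixes a b :: real
  assumes "a > 0" and "b > 0"
  shows "\<forall>\<^sub>F t in at_top. 1 / 16 * exp (t * (a + b)) \<le> sinh (t * a) * sinh (t * b)"
proof -
  \<comment> \<open>As \<open>sinh u\<close> is asymptotic to \<open>exp u / 2\<close>, any factor
    below 1/2 works eventually; taking 1/4 for each sinh gives the 1/16.\<close>
  have *: "\<forall>\<^sub>F t in at_top. exp (t * x) / 4 \<le> sinh (t * x)" if "x > 0" for x :: real
    using that by real_asymp
  show ?thesis
    using *[OF assms(1)] *[OF assms(2)]
  proof eventually_elim
    case (elim t)
    have "exp (t * a) / 4 * (exp (t * b) / 4) \<le> sinh (t * a) * sinh (t * b)"
      \<comment> \<open>\<open>mult_mono\<close> also needs \<open>sinh (t * a)\<close> to be
        nonnegative; this follows from its exponential lower bound, so no sign of \<open>t\<close>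
        is required.\<close>
      using elim order_trans[OF _ elim(1), of 0] by (intro mult_mono) simp_all
    then show ?case
      by (simp add: distrib_left exp_add)
  qed
qed

text \<open>Since \<open>arsinh y = ln (y + sqrt (y^2 + 1))\<close>, the numerator is
  \<open>t * s + ln (2 * k) + o(1)\<close>, and division by \<open>t\<close> removes the
  constant.\<close>

lemma tendsto_arsinh_exp:
  fixes k s :: real
  assumes "k > 0" and "s > 0"
  shows "((\<lambda>t. arsinh (k * exp (t * s)) / t) \<longlongrightarrow> s) at_top"
  using assms unfolding arsinh_real_def by real_asymp

text \<open>A squeeze that reduces both limits to crude exponential bounds: \<open>k\<close> and
  \<open>K\<close> may differ because both envelopes have the same limit.\<close>

lemma tendsto_arsinh_between_exp:
  fixes f :: "real \<Rightarrow> real" and k K s :: real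
  assumes "k > 0" and "K > 0" and "s > 0"
    and lower: "\<forall>\<^sub>F t in at_top. k * exp (t * s) \<le> f t"
    and upper: "\<forall>\<^sub>F t in at_top. f t \<le> K * exp (t * s)"
  shows "((\<lambda>t. arsinh (f t) / t) \<longlongrightarrow> s) at_top"
proof (rule tendsto_sandwich)
  have mono: "arsinh x \<le> arsinh y" if "x \<le> y" for x y :: real
    \<comment> \<open>Both inequalities become negated strict ones, in which simp can cancel
      \<open>arsinh\<close>.\<close>
    using that by (simp flip: not_less)
  show "\<forall>\<^sub>F t in at_top. arsinh (k * exp (t * s)) / t \<le> arsinh (f t) / t"
    using lower eventually_gt_at_top[of 0]
    by eventually_elim (intro divide_right_mono mono, simp_all)
  show "\<forall>\<^sub>F t in at_top. arsinh (f t) / t \<le> arsinh (K * exp (t * s)) / t"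
    using upper eventually_gt_at_top[of 0]
    by eventually_elim (intro divide_right_mono mono, simp_all)
qed (use assms in \<open>auto intro: tendsto_arsinh_exp\<close>)

lemma tendsto_arsinh_sinh_mult:
  fixes a b :: real
  assumes "a > 0" and "b > 0"
  shows "((\<lambda>t. arsinh (sinh (t * a) * sinh (t * b)) / t) \<longlongrightarrow> a + b) at_top"
proof (rule tendsto_arsinh_between_exp)
  show "\<forall>\<^sub>F t in at_top. 1 / 16 * exp (t * (a + b)) \<le> sinh (t * a) * sinh (t * b)"
    using assms by (rule eventually_exp_le_sinh_mult)
  show "\<forall>\<^sub>F t in at_top. sinh (t * a) * sinh (t * b) \<le> 1 / 4 * exp (t * (a + b))"
    using eventually_gt_at_top[of 0]
  proof eventually_elim
    case (elim t)
    then show ?case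
      using sinh_mult_le_exp[of "t * a" "t * b"] assms by (simp add: distrib_left)
  qed
qed (use assms in simp_all)

text \<open>The second product is eventually nonnegative and, as \<open>c + d \<le> a + b\<close>,
  of no larger exponential order than the first, so adding it changes only the constant in the upper
  bound.\<close>

lemma tendsto_arsinh_sinh_mult_add:
  fixes a b c d :: real
  assumes "a > 0" and "b > 0" and "c > 0" and "d > 0" and "c + d \<le> a + b"
  shows "((\<lambda>t. arsinh (sinh (t * a) * sinh (t * b) + sinh (t * c) * sinh (t * d)) / t)
           \<longlongrightarrow> a + b) at_top"
proof (rule tendsto_arsinh_between_exp)
  show "\<forall>\<^sub>F t in at_top. 1 / 16 * exp (t * (a + b))
          \<le> sinh (t * a) * sinh (t * b) + sinh (t * c) * sinh (t * d)"
    using eventually_exp_le_sinh_mult[OF assms(1,2)] eventually_gt_at_top[of 0]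
  proof eventually_elim
    case (elim t)
    then have "0 \<le> sinh (t * c) * sinh (t * d)"
      using assms by simp
    with elim show ?case
      by linarith
  qed
  \<comment> \<open>Each product contributes 1/4 of \<open>exp (t * (a + b))\<close>, hence
    1/2.\<close>
  show "\<forall>\<^sub>F t in at_top. sinh (t * a) * sinh (t * b) + sinh (t * c) * sinh (t * d)
          \<le> 1 / 2 * exp (t * (a + b))"
    using eventually_gt_at_top[of 0]
  proof eventually_elim
    case (elim t)
    have "sinh (t * a) * sinh (t * b) \<le> exp (t * (a + b)) / 4"
      using sinh_mult_le_exp[of "t * a" "t * b"] assms elim by (simp add: distrib_left)
    moreover have "sinh (t * c) * sinh (t * d) \<le> exp (t * (c + d)) / 4"
      using sinh_mult_le_exp[of "t * c" "t * d"] assms elim by (simp add: distrib_left)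
    moreover have "exp (t * (c + d)) \<le> exp (t * (a + b))"
      using assms elim by simp
    ultimately show ?case
      by linarith
  qed
qed (use assms in simp_all)

theorem mainTheorem5:
  fixes a b c d :: real
  assumes "a > 0" and "b > 0" and "c > 0" and "d > 0"
    and "c + d \<le> a + b"
  shows "((\<lambda>\<kappa>::real. 2 / sqrt (- \<kappa>) *
            arsinh (sinh (sqrt (- \<kappa>) / 2 * a) * sinh (sqrt (- \<kappa>) / 2 * b)
                  + sinh (sqrt (- \<kappa>) / 2 * c) * sinh (sqrt (- \<kappa>) / 2 * d)))
          \<longlongrightarrow> max (a + b) (c + d)) at_bot
       \<and> ((\<lambda>\<kappa>::real. 2 / sqrt (- \<kappa>) *
            arsinh (sinh (sqrt (- \<kappa>) / 2 * a) * sinh (sqrt (- \<kappa>) / 2 * b)))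
          \<longlongrightarrow> a + b) at_bot"
proof -
  \<comment> \<open>Substituting this for \<open>t\<close> turns division by \<open>t\<close> into
    the factor \<open>2 / sqrt (- \<kappa>)\<close>.\<close>
  have t: "filterlim (\<lambda>\<kappa>::real. sqrt (- \<kappa>) / 2) at_top at_bot"
    by real_asymp
  have "max (a + b) (c + d) = a + b"
    using assms by simp
  then show ?thesis
    using filterlim_compose[OF tendsto_arsinh_sinh_mult_add[OF assms] t]
      filterlim_compose[OF tendsto_arsinh_sinh_mult[OF assms(1,2)] t]
    by (simp add: mult.commute)
qed

end
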